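(* Let $G$ be a compact (Hausdorff) topological group possessing a split spherical BN-pair $(B,N)$ (with $B,N$ not necessarily closed). Then the associated building $\Delta(G,B)$ is finite; equivalently $[G:B]<\infty$.
   Context: A BN-pair for a group $G$ is a pair of subgroups $B,N$ generating $G$ such that $T:=B\cap N$ is normal in $N$ and $W:=N/T$ is generated by a finite set $S$ of involutions satisfying the usual BN-pair axioms; it is spherical if $W$ is finite. It is split if it is saturated, i.e. $T=\bigcap_{w\in W}wBw^{-1}$, and there exists a nilpotent normal subgroup $U\trianglelefteq B$ with $B=U\rtimes T$. The building $\Delta(G,B)$ has chamber set $G/B$. *)

theory Defs
  imports "HOL-Analysis.Analysis" "HOL-Algebra.Algebra"
begin

definition topological_group :: "('a, 'b) monoid_scheme \<Rightarrow> 'a topology \<Rightarrow> bool" where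
  "topological_group G T \<longleftrightarrow> group G \<and> topspace T = carrier G \<and>
     continuous_map (prod_topology T T) T (\<lambda>(x, y). x \<otimes>\<^bsub>G\<^esub> y) \<and>
     continuous_map T T (\<lambda>x. inv\<^bsub>G\<^esub> x)"

definition commutator_subgroup :: "('a, 'b) monoid_scheme \<Rightarrow> 'a set \<Rightarrow> 'a set \<Rightarrow> 'a set" where
  "commutator_subgroup G A C = generate G
     {a \<otimes>\<^bsub>G\<^esub> c \<otimes>\<^bsub>G\<^esub> inv\<^bsub>G\<^esub> a \<otimes>\<^bsub>G\<^esub> inv\<^bsub>G\<^esub> c | a c. a \<in> A \<and> c \<in> C}"

fun lower_central :: "('a, 'b) monoid_scheme \<Rightarrow> 'a set \<Rightarrow> nat \<Rightarrow> 'a set" where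
  "lower_central G U 0 = U"
| "lower_central G U (Suc n) = commutator_subgroup G (lower_central G U n) U"

definition nilpotent_subgroup :: "('a, 'b) monoid_scheme \<Rightarrow> 'a set \<Rightarrow> bool" where
  "nilpotent_subgroup G U \<longleftrightarrow> subgroup U G \<and> (\<exists>n. lower_central G U n = {\<one>\<^bsub>G\<^esub>})"

definition weyl_group :: "('a, 'b) monoid_scheme \<Rightarrow> 'a set \<Rightarrow> 'a set \<Rightarrow> 'a set monoid" where
  "weyl_group G B N = (G\<lparr>carrier := N\<rparr>) Mod (B \<inter> N)"

text \<open>BN-pair (Tits system) with distinguished generating set S of W.
  Products sBw are taken with arbitrary representatives in N (well defined as T \<subseteq> B).\<close>
definition BN_pair :: "('a, 'b) monoid_scheme \<Rightarrow> 'a set \<Rightarrow> 'a set \<Rightarrow> 'a set set \<Rightarrow> bool" where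
  "BN_pair G B N S \<longleftrightarrow>
     group G \<and> subgroup B G \<and> subgroup N G \<and>
     generate G (B \<union> N) = carrier G \<and>
     normal (B \<inter> N) (G\<lparr>carrier := N\<rparr>) \<and>
     finite S \<and> S \<subseteq> carrier (weyl_group G B N) \<and>
     (\<forall>s\<in>S. s \<noteq> \<one>\<^bsub>weyl_group G B N\<^esub> \<and>
             s \<otimes>\<^bsub>weyl_group G B N\<^esub> s = \<one>\<^bsub>weyl_group G B N\<^esub>) \<and>
     generate (weyl_group G B N) S = carrier (weyl_group G B N) \<and>
     (\<forall>s\<in>S. \<forall>w\<in>carrier (weyl_group G B N). \<forall>ns\<in>s. \<forall>nw\<in>w.
        (ns <#\<^bsub>G\<^esub> B) #>\<^bsub>G\<^esub> nw \<subseteq>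
          ((B #>\<^bsub>G\<^esub> nw) <#>\<^bsub>G\<^esub> B) \<union> ((B #>\<^bsub>G\<^esub> (ns \<otimes>\<^bsub>G\<^esub> nw)) <#>\<^bsub>G\<^esub> B)) \<and>
     (\<forall>s\<in>S. \<forall>ns\<in>s. (ns <#\<^bsub>G\<^esub> B) #>\<^bsub>G\<^esub> ns \<noteq> B)"

definition spherical_BN_pair :: "('a, 'b) monoid_scheme \<Rightarrow> 'a set \<Rightarrow> 'a set \<Rightarrow> 'a set set \<Rightarrow> bool" where
  "spherical_BN_pair G B N S \<longleftrightarrow> BN_pair G B N S \<and> finite (carrier (weyl_group G B N))"

definition split_BN_pair :: "('a, 'b) monoid_scheme \<Rightarrow> 'a set \<Rightarrow> 'a set \<Rightarrow> 'a set set \<Rightarrow> bool" where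
  "split_BN_pair G B N S \<longleftrightarrow> BN_pair G B N S \<and>
     B \<inter> N = (\<Inter>n\<in>N. (n <#\<^bsub>G\<^esub> B) #>\<^bsub>G\<^esub> inv\<^bsub>G\<^esub> n) \<and>
     (\<exists>U. normal U (G\<lparr>carrier := B\<rparr>) \<and> nilpotent_subgroup G U \<and>
          U <#>\<^bsub>G\<^esub> (B \<inter> N) = B \<and> U \<inter> (B \<inter> N) = {\<one>\<^bsub>G\<^esub>})"

end

theory Submission
  imports Defs
begin

text \<open>
  Let \<open>H\<close> be the set of all \<open>g\<close> such that \<open>B g B\<close> is a union of finitely many left cosets of \<open>B\<close>.
  As \<open>G = B N B\<close> and \<open>W\<close> is finite, \<open>H\<close> is a subgroup in which \<open>B\<close> has finite index. If
  \<open>g\<inverse> U g \<subseteq> H\<close> then \<open>g \<in> H\<close>: reduce to \<open>g = n \<in> N\<close>; then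
  \<open>n\<inverse> B n = (n\<inverse> U n) (B \<inter> N) \<subseteq> H\<close> is covered by finitely many cosets of \<open>B\<close>.
  This criterion shows, by descending induction along the closures of the terms of the lower central
  series of \<open>U\<close> (the last one is trivial as \<open>G\<close> is Hausdorff), that the closure of \<open>U\<close> lies in
  \<open>H\<close>. The closure \<open>P\<close> of \<open>B\<close> conjugates \<open>U\<close> into the closure of \<open>U\<close>, so the criterion gives
  \<open>P \<subseteq> H\<close> and \<open>[P : B]\<close> is finite. Finally \<open>G\<close> is a finite union of double cosets of \<open>P\<close>, all of
  them compact, so \<open>P\<close> is open and \<open>[G : P]\<close> is finite.
\<close>

section \<open>Finitely covered double cosets\<close>

context group
begin

text \<open>The condition is equivalent to \<open>B \<inter> g B g\<inverse>\<close> having finite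
  index in \<open>B\<close>. It is one-sided in \<open>g\<close>, so stability under products is
  immediate, whereas stability under inverses is not.\<close>

definition almost_normalizer :: "'a set \<Rightarrow> 'a set" where
  "almost_normalizer B =
     {g \<in> carrier G. \<exists>F. finite F \<and> F \<subseteq> carrier G \<and> B #> g \<subseteq> F <#> B}"

lemma inv_mult_cancel_left:
  assumes "x \<in> carrier G" "y \<in> carrier G"
  shows "inv x \<otimes> (x \<otimes> y) = y" and "x \<otimes> (inv x \<otimes> y) = y"
  using assms by (simp_all add: m_assoc[symmetric])

lemma finite_set_mult:
  assumes "finite A" "finite C"
  shows "finite (A <#> C)"
  using assms by (auto simp: set_mult_def)

lemma subgroup_subset_almost_normalizer:
  assumes "subgroup B G"
  shows "B \<subseteq> almost_normalizer B"
proof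
  fix g assume g: "g \<in> B"
  interpret B: subgroup B G by fact
  have "B #> g \<subseteq> {\<one>} <#> B"
    using g by (fastforce simp: r_coset_def set_mult_def)
  then show "g \<in> almost_normalizer B"
    using g B.subset unfolding almost_normalizer_def by blast
qed

text \<open>Coverings compose: \<open>B g h\<close> lies in \<open>F B h\<close>, and the covering
  of \<open>B h\<close> turns this into \<open>F F' B\<close>.\<close>

lemma almost_normalizer_mult_closed:
  assumes B: "subgroup B G" and g: "g \<in> almost_normalizer B" and h: "h \<in> almost_normalizer B"
  shows "g \<otimes> h \<in> almost_normalizer B"
proof -
  interpret B: subgroup B G by fact
  obtain F where F: "finite F" "F \<subseteq> carrier G" "B #> g \<subseteq> F <#> B" and gc: "g \<in> carrier G"
    using g by (auto simp: almost_normalizer_def)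
  obtain F' where F': "finite F'" "F' \<subseteq> carrier G" "B #> h \<subseteq> F' <#> B" and hc: "h \<in> carrier G"
    using h by (auto simp: almost_normalizer_def)
  have "B #> (g \<otimes> h) = (B #> g) #> h"
    using gc hc B.subset by (simp add: coset_mult_assoc)
  also have "\<dots> \<subseteq> (F <#> B) #> h"
    using F(3) by (auto simp: r_coset_def)
  also have "\<dots> = F <#> (B #> h)"
    using F(2) B.subset hc by (simp add: setmult_rcos_assoc)
  also have "\<dots> \<subseteq> F <#> (F' <#> B)"
    using F'(3) by (intro mono_set_mult) auto
  also have "\<dots> = (F <#> F') <#> B"
    using F(2) F'(2) B.subset by (simp add: set_mult_assoc)
  finally have "B #> (g \<otimes> h) \<subseteq> (F <#> F') <#> B" .
  moreover have "finite (F <#> F')" "F <#> F' \<subseteq> carrier G"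
    using F F' by (simp_all add: finite_set_mult set_mult_closed)
  ultimately show ?thesis
    using gc hc unfolding almost_normalizer_def by blast
qed

lemma almost_normalizer_nat_pow_closed:
  assumes "subgroup B G" "g \<in> almost_normalizer B"
  shows "g [^] (k::nat) \<in> almost_normalizer B"
proof (induction k)
  case 0
  then show ?case
    using subgroup_subset_almost_normalizer[OF assms(1)] subgroup.one_closed[OF assms(1)]
    by auto
next
  case (Suc k)
  then show ?case
    using assms almost_normalizer_mult_closed by simp
qed

lemma finite_lcosets_if_finitely_covered:
  assumes B: "subgroup B G" and "finite F" "F \<subseteq> carrier G" "carrier G \<subseteq> F <#> B"
  shows "finite (lcosets B)"
proof -
  interpret B: subgroup B G by fact
  have "lcosets B \<subseteq> (\<lambda>f. f <# B) ` F"
  proof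
    fix C assume "C \<in> lcosets B"
    then obtain g where g: "g \<in> carrier G" "C = g <# B"
      by (auto simp: LCOSETS_def)
    then obtain f b where fb: "f \<in> F" "b \<in> B" "g = f \<otimes> b"
      using assms(4) by (auto simp: set_mult_def)
    have "g <# B = f <# (b <# B)"
      using fb assms(3) B.subset B.mem_carrier by (auto simp: lcos_m_assoc)
    also have "b <# B = B"
      using fb(2) B by (simp add: coset_join3)
    finally show "C \<in> (\<lambda>f. f <# B) ` F"
      using g fb by auto
  qed
  then show ?thesis
    using assms(2) finite_surj by blast
qed

end

text \<open>Isolates what the finiteness argument takes from the BN-pair: the Bruhat decomposition,
  \<open>B \<inter> N\<close> stable under conjugation by \<open>N\<close>, and the finiteness of
  the Weyl group, expressed through cosets of \<open>B \<inter> N\<close>.\<close>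

locale finite_bruhat_decomposition = group G for G (structure) +
  fixes B N :: "'a set"
  assumes subgroup_B: "subgroup B G"
    and subgroup_N: "subgroup N G"
    and conj_B_inter_N: "\<lbrakk>n \<in> N; t \<in> B \<inter> N\<rbrakk> \<Longrightarrow> n \<otimes> t \<otimes> inv n \<in> B \<inter> N"
    and finite_cosets: "finite ((\<lambda>n. (B \<inter> N) #> n) ` N)"
    and bruhat: "g \<in> carrier G \<Longrightarrow> \<exists>b\<in>B. \<exists>n\<in>N. \<exists>b'\<in>B. g = b \<otimes> n \<otimes> b'"
begin

sublocale B: subgroup B G by (fact subgroup_B)
sublocale N: subgroup N G by (fact subgroup_N)
sublocale T: subgroup "B \<inter> N" G
  using subgroup_B subgroup_N by (rule subgroups_Inter_pair)

abbreviation "H \<equiv> almost_normalizer B"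

lemma H_carrier: "g \<in> H \<Longrightarrow> g \<in> carrier G"
  by (simp add: almost_normalizer_def)

lemmas B_subset_H = subgroup_subset_almost_normalizer[OF subgroup_B]
lemmas H_mult = almost_normalizer_mult_closed[OF subgroup_B]

text \<open>Pigeonhole on the cosets of the powers of \<open>n\<close>: two of them coincide, and
  the quotient of the two powers lies in \<open>B \<inter> N\<close>.\<close>

lemma N_pow_in_B:
  assumes n: "n \<in> N"
  obtains k :: nat where "n [^] Suc k \<in> B"
proof -
  have pow: "n [^] i \<in> N" for i :: nat
    using n by (induction i) auto
  then have "range (\<lambda>i::nat. (B \<inter> N) #> (n [^] i)) \<subseteq> (\<lambda>n. (B \<inter> N) #> n) ` N"
    by blast
  then have "finite (range (\<lambda>i::nat. (B \<inter> N) #> (n [^] i)))"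
    using finite_cosets finite_subset by blast
  then have "\<not> inj (\<lambda>i::nat. (B \<inter> N) #> (n [^] i))"
    using finite_imageD infinite_UNIV_nat by blast
  then obtain i j :: nat where "i < j" and ij: "(B \<inter> N) #> (n [^] i) = (B \<inter> N) #> (n [^] j)"
    unfolding inj_def by (metis linorder_neqE_nat)
  \<comment> \<open>Writing the gap as \<open>Suc k\<close> keeps the exponent positive, so that
    \<open>n [^] k\<close> is still an available factor when \<open>inv n\<close> is expressed
    later.\<close>
  then obtain k where k: "j = Suc k + i"
    by (metis add.commute add_Suc_right less_imp_Suc_add)
  have "n [^] j \<in> (B \<inter> N) #> (n [^] i)"
    using rcos_self[OF _ T.is_subgroup] pow ij by auto
  then obtain t where t: "t \<in> B \<inter> N" "n [^] j = t \<otimes> n [^] i"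
    by (auto simp: r_coset_def)
  have "n [^] j = n [^] Suc k \<otimes> n [^] i"
    using n nat_pow_mult[of n "Suc k" i] k by simp
  then have "n [^] Suc k = t"
    using t pow n by (metis IntE B.mem_carrier N.mem_carrier r_cancel)
  then show ?thesis
    using that t by blast
qed

text \<open>Elements of \<open>B\<close> and their inverses lie in \<open>H\<close>, so the Bruhat
  decomposition reduces the claim to \<open>n \<in> N\<close>. There a positive power of
  \<open>n\<close> lies in \<open>B\<close>, hence \<open>inv n\<close> is a nonnegative power of
  \<open>n\<close> times an element of \<open>B\<close>, and closure under products
  suffices.\<close>

lemma H_inv:
  assumes "g \<in> H"
  shows "inv g \<in> H"
proof -
  obtain b n b' where g: "b \<in> B" "n \<in> N" "b' \<in> B" "g = b \<otimes> n \<otimes> b'"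
    using bruhat[OF H_carrier[OF assms]] by blast
  have "inv b \<in> H" "inv b' \<in> H"
    using g B_subset_H by auto
  then have "inv b \<otimes> g \<otimes> inv b' \<in> H"
    using assms by (intro H_mult)
  moreover have "inv b \<otimes> g \<otimes> inv b' = n"
    using g by (simp add: m_assoc inv_mult_cancel_left)
  ultimately have "n \<in> H"
    by simp
  obtain k where k: "n [^] Suc k \<in> B"
    using N_pow_in_B[OF g(2)] .
  have "inv n = n [^] k \<otimes> inv (n [^] Suc k)"
    unfolding nat_pow_Suc2[OF N.mem_carrier[OF g(2)]]
    using g(2) by (simp add: inv_mult_group inv_mult_cancel_left)
  moreover have "inv (n [^] Suc k) \<in> H"
    using k B_subset_H by blast
  ultimately have "inv n \<in> H"
    using almost_normalizer_nat_pow_closed[OF subgroup_B \<open>n \<in> H\<close>, of k] H_mult by metis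
  moreover have "inv g = inv b' \<otimes> inv n \<otimes> inv b"
    using g by (simp add: inv_mult_group m_assoc)
  ultimately show ?thesis
    using \<open>inv b \<in> H\<close> \<open>inv b' \<in> H\<close> H_mult by metis
qed

lemma H_mult_cancel_left: "\<lbrakk>x \<in> H; y \<in> carrier G; x \<otimes> y \<in> H\<rbrakk> \<Longrightarrow> y \<in> H"
  using H_mult[OF H_inv, of x "x \<otimes> y"] H_carrier[of x] by (simp add: m_assoc[symmetric])

lemma H_mult_cancel_right: "\<lbrakk>y \<in> H; x \<in> carrier G; x \<otimes> y \<in> H\<rbrakk> \<Longrightarrow> x \<in> H"
  using H_mult[OF _ H_inv, of "x \<otimes> y" y] H_carrier[of y] by (simp add: m_assoc)

text \<open>Choose one representative in each coset of \<open>B \<inter> N\<close>; the factor from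
  \<open>B \<inter> N\<close> by which \<open>n\<close> differs from it is absorbed into the left
  factor from \<open>B\<close>.\<close>

lemma finite_representatives:
  obtains R where "finite R" "R \<subseteq> N"
    "\<And>g. g \<in> carrier G \<Longrightarrow> \<exists>b\<in>B. \<exists>r\<in>R. \<exists>b'\<in>B. g = b \<otimes> r \<otimes> b'"
proof -
  obtain R where R: "finite R" "R \<subseteq> N" "(\<lambda>n. (B \<inter> N) #> n) ` N = (\<lambda>n. (B \<inter> N) #> n) ` R"
    using finite_subset_image[OF finite_cosets subset_refl] by auto
  have "\<exists>b\<in>B. \<exists>r\<in>R. \<exists>b'\<in>B. g = b \<otimes> r \<otimes> b'" if gc: "g \<in> carrier G" for g
  proof -
    obtain b n b' where g: "b \<in> B" "n \<in> N" "b' \<in> B" "g = b \<otimes> n \<otimes> b'"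
      using bruhat[OF gc] by blast
    obtain r where r: "r \<in> R" "(B \<inter> N) #> n = (B \<inter> N) #> r"
      using R(3) g(2) by (metis (no_types, lifting) imageE imageI)
    have "n \<in> (B \<inter> N) #> r"
      using r(2) rcos_self[OF _ T.is_subgroup] g(2) by auto
    then obtain t where t: "t \<in> B \<inter> N" "n = t \<otimes> r"
      by (auto simp: r_coset_def)
    have "g = (b \<otimes> t) \<otimes> r \<otimes> b'"
      using g t r R(2) by (auto simp: m_assoc subset_iff)
    then show ?thesis
      using g(1,3) t(1) r(1) by blast
  qed
  then show ?thesis
    using R that by blast
qed

text \<open>\<open>H\<close> is a union of double cosets \<open>B r B\<close> with \<open>r\<close>
  among finitely many representatives, and those \<open>r\<close> lie in \<open>H\<close>
  themselves, so each contributes a finite covering set.\<close>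

lemma H_finitely_covered:
  obtains F where "finite F" "F \<subseteq> carrier G" "H \<subseteq> F <#> B"
proof -
  obtain R where R: "finite R" "R \<subseteq> N"
    "\<And>g. g \<in> carrier G \<Longrightarrow> \<exists>b\<in>B. \<exists>r\<in>R. \<exists>b'\<in>B. g = b \<otimes> r \<otimes> b'"
    using finite_representatives by blast
  have "\<forall>r\<in>R \<inter> H. \<exists>F. finite F \<and> F \<subseteq> carrier G \<and> B #> r \<subseteq> F <#> B"
    by (simp add: almost_normalizer_def)
  then obtain F where F: "\<And>r. r \<in> R \<inter> H \<Longrightarrow> finite (F r) \<and> F r \<subseteq> carrier G \<and> B #> r \<subseteq> F r <#> B"
    by metis
  have "H \<subseteq> (\<Union>r\<in>R \<inter> H. F r) <#> B"
  proof
    fix g assume "g \<in> H"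
    then obtain b r b' where g: "b \<in> B" "r \<in> R" "b' \<in> B" "g = b \<otimes> r \<otimes> b'"
      using R(3) H_carrier by blast
    have rc: "r \<in> carrier G"
      using g(2) R(2) by auto
    \<comment> \<open>Cancelling \<open>b'\<close> and then \<open>b\<close>, both in
      \<open>H\<close>, shows that the representative itself is in \<open>H\<close>.\<close>
    have "b \<otimes> r \<in> H"
      using H_mult_cancel_right[of b' "b \<otimes> r"] g \<open>g \<in> H\<close> B_subset_H rc by auto
    then have r: "r \<in> R \<inter> H"
      using H_mult_cancel_left[of b r] g B_subset_H rc by auto
    then have "b \<otimes> r \<in> F r <#> B"
      using F g(1) by (force simp: r_coset_def)
    then obtain f b'' where f: "f \<in> F r" "b'' \<in> B" "b \<otimes> r = f \<otimes> b''"
      by (auto simp: set_mult_def)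
    then have "g = f \<otimes> (b'' \<otimes> b')"
      using g F[OF r] by (auto simp: m_assoc)
    then show "g \<in> (\<Union>r\<in>R \<inter> H. F r) <#> B"
      using f g(3) r by (auto simp: set_mult_def)
  qed
  moreover have "finite (\<Union>r\<in>R \<inter> H. F r)" "(\<Union>r\<in>R \<inter> H. F r) \<subseteq> carrier G"
    using F R(1) by auto
  ultimately show ?thesis
    using that by blast
qed

text \<open>Since \<open>n\<close> normalizes \<open>B \<inter> N\<close>, all of
  \<open>n\<inverse> B n\<close> falls into \<open>H\<close>. A finite covering of \<open>H\<close>
  by left cosets of \<open>B\<close>, translated by \<open>n\<close>, then covers
  \<open>B n = n (n\<inverse> B n)\<close>; this is the origin of \<open>n <# F\<close>.\<close>

lemma N_in_H_if_conj_subset: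
  assumes n: "n \<in> N" and U: "U \<subseteq> carrier G" "B \<subseteq> U <#> (B \<inter> N)"
    and conj: "\<And>u. u \<in> U \<Longrightarrow> inv n \<otimes> u \<otimes> n \<in> H"
  shows "n \<in> H"
proof -
  obtain F where F: "finite F" "F \<subseteq> carrier G" "H \<subseteq> F <#> B"
    using H_finitely_covered .
  have "B #> n \<subseteq> (n <# F) <#> B"
  proof
    fix x assume "x \<in> B #> n"
    then obtain b where b: "b \<in> B" "x = b \<otimes> n"
      by (auto simp: r_coset_def)
    then obtain u t where ut: "u \<in> U" "t \<in> B \<inter> N" "b = u \<otimes> t"
      using U(2) by (auto simp: set_mult_def)
    have uc: "u \<in> carrier G"
      using U(1) ut(1) by auto
    have "inv n \<otimes> t \<otimes> n \<in> H"
      using conj_B_inter_N[of "inv n" t] n ut(2) B_subset_H by auto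
    then have "(inv n \<otimes> u \<otimes> n) \<otimes> (inv n \<otimes> t \<otimes> n) \<in> H"
      using conj ut(1) H_mult by blast
    moreover have "(inv n \<otimes> u \<otimes> n) \<otimes> (inv n \<otimes> t \<otimes> n) = inv n \<otimes> x"
      using b ut n uc by (auto simp: m_assoc inv_mult_cancel_left)
    ultimately obtain f b' where f: "f \<in> F" "b' \<in> B" "inv n \<otimes> x = f \<otimes> b'"
      using F(3) by (auto simp: set_mult_def)
    have xc: "x \<in> carrier G"
      using b n by auto
    have "x = n \<otimes> (inv n \<otimes> x)"
      using n xc by (simp add: inv_mult_cancel_left)
    then have "x = (n \<otimes> f) \<otimes> b'"
      using f F(2) n by (auto simp: m_assoc)
    then show "x \<in> (n <# F) <#> B"
      using f by (auto simp: set_mult_def l_coset_def)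
  qed
  moreover have "finite (n <# F)" "n <# F \<subseteq> carrier G"
    using F n by (auto simp: l_coset_def)
  ultimately show ?thesis
    using N.mem_carrier[OF n] unfolding almost_normalizer_def by blast
qed

lemma in_H_if_conj_subset:
  assumes x: "x \<in> carrier G" and U: "U \<subseteq> carrier G" "B \<subseteq> U <#> (B \<inter> N)"
    and norm: "\<And>b u. \<lbrakk>b \<in> B; u \<in> U\<rbrakk> \<Longrightarrow> b \<otimes> u \<otimes> inv b \<in> U"
    and conj: "\<And>u. u \<in> U \<Longrightarrow> inv x \<otimes> u \<otimes> x \<in> H"
  shows "x \<in> H"
proof -
  obtain b n b' where g: "b \<in> B" "n \<in> N" "b' \<in> B" "x = b \<otimes> n \<otimes> b'"
    using bruhat[OF x] by blast
  have "inv n \<otimes> u \<otimes> n \<in> H" if u: "u \<in> U" for u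
  proof -
    have uc: "u \<in> carrier G" using u U(1) by auto
    \<comment> \<open>Replacing \<open>u\<close> by its conjugate \<open>b u b\<inverse>\<close>,
      again in \<open>U\<close>, absorbs the left factor of \<open>x\<close>; the right factor
      \<open>b'\<close> only conjugates by an element of \<open>H\<close>.\<close>
    have "inv n \<otimes> u \<otimes> n = b' \<otimes> (inv x \<otimes> (b \<otimes> u \<otimes> inv b) \<otimes> x) \<otimes> inv b'"
      using g uc by (simp add: inv_mult_group m_assoc inv_mult_cancel_left)
    also have "\<dots> \<in> H"
      using conj[OF norm[OF g(1) u]] g(3) B_subset_H by (auto intro!: H_mult)
    finally show ?thesis .
  qed
  then have "n \<in> H"
    using N_in_H_if_conj_subset[OF g(2) U] by blast
  then show ?thesis
    using g B_subset_H by (auto intro!: H_mult)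
qed

end

section \<open>Closures in topological groups\<close>

lemma topological_group_continuous_mult:
  fixes G (structure)
  assumes "topological_group G \<tau>" "continuous_map Y \<tau> f" "continuous_map Y \<tau> g"
  shows "continuous_map Y \<tau> (\<lambda>x. f x \<otimes> g x)"
proof -
  have "continuous_map Y (prod_topology \<tau> \<tau>) (\<lambda>x. (f x, g x))"
    using assms(2,3) by (simp add: continuous_map_paired)
  then have "continuous_map Y \<tau> ((\<lambda>(x, y). x \<otimes> y) \<circ> (\<lambda>x. (f x, g x)))"
    using assms(1) continuous_map_compose unfolding topological_group_def by blast
  then show ?thesis
    by (simp add: comp_def)
qed

lemma topological_group_continuous_inv:
  fixes G (structure)
  assumes "topological_group G \<tau>" "continuous_map Y \<tau> f"
  shows "continuous_map Y \<tau> (\<lambda>x. inv (f x))"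
  using continuous_map_compose[of Y \<tau> f \<tau> "\<lambda>x. inv x"] assms
  by (simp add: topological_group_def comp_def)

lemmas topological_group_continuous_intros =
  topological_group_continuous_mult topological_group_continuous_inv

text \<open>The device by which algebraic relations are passed from a subset to its closure, one
  variable at a time.\<close>

lemma continuous_map_closure_of_mem:
  assumes "continuous_map \<tau> Y f" "x \<in> \<tau> closure_of A"
    and "\<And>a. a \<in> A \<Longrightarrow> f a \<in> Y closure_of C"
  shows "f x \<in> Y closure_of C"
proof -
  have "f x \<in> Y closure_of (f ` A)"
    using continuous_map_image_closure_subset[OF assms(1)] assms(2) by blast
  also have "\<dots> \<subseteq> Y closure_of C"
    using assms(3) by (intro closure_of_minimal) auto
  finally show ?thesis .
qed

lemma topological_group_subgroup_closure_of:
  fixes G (structure)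
  assumes \<tau>: "topological_group G \<tau>" and A: "subgroup A G"
  shows "subgroup (\<tau> closure_of A) G"
proof -
  interpret group G
    using \<tau> by (simp add: topological_group_def)
  interpret A: subgroup A G by fact
  have top: "topspace \<tau> = carrier G"
    using \<tau> by (simp add: topological_group_def)
  have carr: "\<tau> closure_of A \<subseteq> carrier G"
    using closure_of_subset_topspace top by metis
  have A_sub: "A \<subseteq> \<tau> closure_of A"
    using closure_of_subset[of A \<tau>] A.subset top by simp
  \<comment> \<open>First the left factor ranges over the closure with the right factor fixed in
    \<open>A\<close>; afterwards the left factor is fixed in the closure and the right one
    varies.\<close>
  have mult_right: "x \<otimes> a \<in> \<tau> closure_of A" if "x \<in> \<tau> closure_of A" "a \<in> A" for x a
    using that A_sub top
    by (intro continuous_map_closure_of_mem[of \<tau> \<tau> "\<lambda>x. x \<otimes> a" x A A])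
      (auto intro!: topological_group_continuous_intros[OF \<tau>])
  show ?thesis
  proof
    show "x \<otimes> y \<in> \<tau> closure_of A" if "x \<in> \<tau> closure_of A" "y \<in> \<tau> closure_of A" for x y
      using that mult_right carr top
      by (intro continuous_map_closure_of_mem[of \<tau> \<tau> "\<lambda>y. x \<otimes> y" y A A])
        (auto intro!: topological_group_continuous_intros[OF \<tau>])
    show "inv x \<in> \<tau> closure_of A" if "x \<in> \<tau> closure_of A" for x
      using that A_sub
      by (intro continuous_map_closure_of_mem[of \<tau> \<tau> "\<lambda>y. inv y" x A A])
        (auto intro!: topological_group_continuous_intros[OF \<tau>])
  qed (use carr A_sub in auto)
qed

lemma compact_group_openin_subgroup_finitely_covers:
  fixes G (structure)
  assumes \<tau>: "topological_group G \<tau>" and "compact_space \<tau>"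
    and P: "subgroup P G" "openin \<tau> P"
  obtains F where "finite F" "F \<subseteq> carrier G" "carrier G \<subseteq> F <#> P"
proof -
  interpret group G
    using \<tau> by (simp add: topological_group_def)
  interpret P: subgroup P G by fact
  have top: "topspace \<tau> = carrier G"
    using \<tau> by (simp add: topological_group_def)
  \<comment> \<open>A coset of \<open>P\<close> is the preimage of \<open>P\<close> under left
    translation by \<open>inv g\<close>. Compactness then extracts a finite subcover from the cover
    by all cosets.\<close>
  have op: "openin \<tau> (g <# P)" if g: "g \<in> carrier G" for g
  proof -
    have "continuous_map \<tau> \<tau> (\<lambda>x. inv g \<otimes> x)"
      using g top by (auto intro!: topological_group_continuous_intros[OF \<tau>])
    then have "openin \<tau> {x \<in> topspace \<tau>. inv g \<otimes> x \<in> P}"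
      using P(2) by (rule openin_continuous_map_preimage)
    also have "{x \<in> topspace \<tau>. inv g \<otimes> x \<in> P} = g <# P"
    proof -
      have "x \<in> g <# P" if "x \<in> carrier G" "inv g \<otimes> x \<in> P" for x
        using that g inv_mult_cancel_left(2)[OF g that(1)] unfolding l_coset_def by force
      then show ?thesis
        using g top by (auto simp: l_coset_def inv_mult_cancel_left)
    qed
    finally show ?thesis .
  qed
  have "g \<in> g <# P" if "g \<in> carrier G" for g
    using that P.one_closed unfolding l_coset_def by force
  then have "topspace \<tau> \<subseteq> \<Union>((\<lambda>g. g <# P) ` carrier G)"
    using top by blast
  moreover have "\<And>V. V \<in> (\<lambda>g. g <# P) ` carrier G \<Longrightarrow> openin \<tau> V"
    using op by blast
  ultimately obtain \<F> where \<F>: "finite \<F>" "\<F> \<subseteq> (\<lambda>g. g <# P) ` carrier G" "topspace \<tau> \<subseteq> \<Union>\<F>"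
    using assms(2) unfolding compact_space_alt by meson
  then obtain F where F: "F \<subseteq> carrier G" "finite F" "\<F> = (\<lambda>g. g <# P) ` F"
    using finite_subset_image by metis
  have "carrier G \<subseteq> F <#> P"
    using \<F>(3) F(3) top by (auto simp: set_mult_def l_coset_def)
  then show ?thesis
    using F that by blast
qed

text \<open>The complement of \<open>P\<close> is the union of the double cosets
  \<open>P r P\<close> with \<open>r \<in> R - P\<close>. Each is a continuous image of the compact
  set \<open>P \<times> P\<close>, hence closed, and there are finitely many.\<close>

lemma compact_group_openin_closed_subgroup:
  fixes G (structure)
  assumes \<tau>: "topological_group G \<tau>" and "compact_space \<tau>" "Hausdorff_space \<tau>"
    and P: "subgroup P G" "closedin \<tau> P"
    and R: "finite R" "R \<subseteq> carrier G"
    and cover: "\<And>g. g \<in> carrier G \<Longrightarrow> \<exists>p\<in>P. \<exists>r\<in>R. \<exists>q\<in>P. g = p \<otimes> r \<otimes> q"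
  shows "openin \<tau> P"
proof -
  interpret group G
    using \<tau> by (simp add: topological_group_def)
  interpret P: subgroup P G by fact
  have top: "topspace \<tau> = carrier G"
    using \<tau> by (simp add: topological_group_def)
  define D where "D r = (\<lambda>(p, q). p \<otimes> r \<otimes> q) ` (P \<times> P)" for r
  have closed: "closedin \<tau> (D r)" if "r \<in> R" for r
  proof -
    have "continuous_map (prod_topology \<tau> \<tau>) \<tau> (\<lambda>z. fst z \<otimes> r \<otimes> snd z)"
      using that R top
      by (auto intro!: topological_group_continuous_intros[OF \<tau>] continuous_map_fst continuous_map_snd)
    moreover have "compactin (prod_topology \<tau> \<tau>) (P \<times> P)"
      using assms(2) P(2) by (simp add: compactin_Times closedin_compact_space)
    ultimately have "compactin \<tau> (D r)"
      using image_compactin unfolding D_def by (fastforce simp: case_prod_unfold)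
    then show ?thesis
      using assms(3) compactin_imp_closedin by blast
  qed
  have notin: "p \<otimes> r \<otimes> q \<notin> P" if "r \<in> R - P" "p \<in> P" "q \<in> P" for p q r
  proof
    assume "p \<otimes> r \<otimes> q \<in> P"
    then have "inv p \<otimes> (p \<otimes> r \<otimes> q) \<otimes> inv q \<in> P"
      using that by blast
    moreover have "inv p \<otimes> (p \<otimes> r \<otimes> q) \<otimes> inv q = r"
      using that R(2) by (auto simp: m_assoc inv_mult_cancel_left subset_iff)
    ultimately show False
      using that by simp
  qed
  have "topspace \<tau> - P = \<Union>(D ` (R - P))"
  proof
    show "topspace \<tau> - P \<subseteq> \<Union>(D ` (R - P))"
    proof
      fix g assume g: "g \<in> topspace \<tau> - P"
      then obtain p r q where pq: "p \<in> P" "r \<in> R" "q \<in> P" "g = p \<otimes> r \<otimes> q"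
        using cover top by blast
      then have "r \<notin> P"
        using g by auto
      then show "g \<in> \<Union>(D ` (R - P))"
        using pq by (force simp: D_def)
    qed
    show "\<Union>(D ` (R - P)) \<subseteq> topspace \<tau> - P"
      using notin R(2) top by (auto simp: D_def)
  qed
  moreover have "closedin \<tau> (\<Union>(D ` (R - P)))"
    using closed R(1) by (intro closedin_Union) auto
  ultimately show ?thesis
    using P.subset top by (simp add: openin_closedin_eq)
qed

section \<open>Split decompositions of compact groups\<close>

context finite_bruhat_decomposition
begin

lemma lower_central_subset_carrier:
  assumes "U \<subseteq> carrier G"
  shows "lower_central G U i \<subseteq> carrier G"
proof (induction i)
  case 0
  then show ?case using assms by simp
next
  case (Suc i)
  then have "{a \<otimes> c \<otimes> inv a \<otimes> inv c | a c. a \<in> lower_central G U i \<and> c \<in> U} \<subseteq> carrier G"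
    using assms by blast
  then show ?case
    by (simp add: commutator_subgroup_def generate_incl)
qed

text \<open>Bracketing an element of the closure of one lower central term with
  \<open>u \<in> U\<close> lands in the closure of the next term, which is in \<open>H\<close> by
  induction. As \<open>u\<close> itself is in \<open>H\<close>, the conjugate of \<open>u\<close> is
  too, and the conjugation criterion applies.\<close>

lemma closure_nilpotent_subset_H:
  assumes \<tau>: "topological_group G \<tau>" "Hausdorff_space \<tau>"
    and U: "U \<subseteq> B" "B \<subseteq> U <#> (B \<inter> N)" "nilpotent_subgroup G U"
    and norm: "\<And>b u. \<lbrakk>b \<in> B; u \<in> U\<rbrakk> \<Longrightarrow> b \<otimes> u \<otimes> inv b \<in> U"
  shows "\<tau> closure_of U \<subseteq> H"
proof -
  have top: "topspace \<tau> = carrier G"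
    using \<tau> by (simp add: topological_group_def)
  have Uc: "U \<subseteq> carrier G"
    using U(1) B.subset by blast
  obtain m where m: "lower_central G U m = {\<one>}"
    using U(3) by (auto simp: nilpotent_subgroup_def)
  have "\<tau> closure_of {\<one>} = {\<one>}"
    using \<tau>(2) top by (simp add: closure_of_closedin closedin_Hausdorff_singleton)
  then have base: "\<tau> closure_of (lower_central G U m) \<subseteq> H"
    using m B_subset_H by auto
  have step: "\<tau> closure_of (lower_central G U i) \<subseteq> H"
    if IH: "\<tau> closure_of (lower_central G U (Suc i)) \<subseteq> H" for i
  proof
    fix x assume x: "x \<in> \<tau> closure_of (lower_central G U i)"
    then have xc: "x \<in> carrier G"
      using top by (simp add: in_closure_of)
    have "x \<otimes> u \<otimes> inv x \<in> H" if u: "u \<in> U" for u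
    proof -
      have uc: "u \<in> carrier G" using u Uc by auto
      have "a \<otimes> u \<otimes> inv a \<otimes> inv u \<in> \<tau> closure_of (lower_central G U (Suc i))"
        if a: "a \<in> lower_central G U i" for a
      proof -
        have "a \<otimes> u \<otimes> inv a \<otimes> inv u \<in> lower_central G U (Suc i)"
          using a u by (auto simp: commutator_subgroup_def intro!: generate.incl)
        moreover have "lower_central G U (Suc i) \<subseteq> topspace \<tau>"
          using lower_central_subset_carrier[OF Uc] top by blast
        ultimately show ?thesis
          using closure_of_subset by blast
      qed
      \<comment> \<open>Only the first entry of the commutator moves to the closure;
        \<open>u\<close> stays fixed in \<open>U\<close>.\<close>
      then have "x \<otimes> u \<otimes> inv x \<otimes> inv u \<in> \<tau> closure_of (lower_central G U (Suc i))"
        using uc top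
        by (intro continuous_map_closure_of_mem[OF _ x, of \<tau> "\<lambda>x. x \<otimes> u \<otimes> inv x \<otimes> inv u"])
          (auto intro!: topological_group_continuous_intros[OF \<tau>(1)])
      then have "x \<otimes> u \<otimes> inv x \<otimes> inv u \<in> H"
        using IH by blast
      moreover have "inv u \<in> H"
        using u U(1) B_subset_H by blast
      ultimately show ?thesis
        using H_mult_cancel_right[of "inv u" "x \<otimes> u \<otimes> inv x"] xc uc by blast
    qed
    \<comment> \<open>The criterion conjugates in the opposite direction, so it is applied to
      \<open>inv x\<close>, and \<open>H_inv\<close> brings the result back to
      \<open>x\<close>.\<close>
    then have "inv (inv x) \<otimes> u \<otimes> inv x \<in> H" if "u \<in> U" for u
      using that xc by simp
    then have "inv x \<in> H"
      using in_H_if_conj_subset[OF inv_closed[OF xc] Uc U(2) norm] by blast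
    then show "x \<in> H"
      using H_inv[of "inv x"] xc by simp
  qed
  \<comment> \<open>Induction descends from the trivial term \<open>m\<close> to index 0, where the
    series starts with \<open>U\<close> itself.\<close>
  have "\<tau> closure_of (lower_central G U 0) \<subseteq> H"
    by (rule inc_induct[of 0 m]) (use base step in auto)
  then show ?thesis by simp
qed

text \<open>\<open>B\<close> normalizes \<open>U\<close>, so by continuity of
  \<open>x \<mapsto> x\<inverse> u x\<close> its closure conjugates \<open>U\<close> into the
  closure of \<open>U\<close>, already known to lie in \<open>H\<close>.\<close>

lemma closure_B_subset_H:
  assumes \<tau>: "topological_group G \<tau>" "Hausdorff_space \<tau>"
    and U: "U \<subseteq> B" "B \<subseteq> U <#> (B \<inter> N)" "nilpotent_subgroup G U"
    and norm: "\<And>b u. \<lbrakk>b \<in> B; u \<in> U\<rbrakk> \<Longrightarrow> b \<otimes> u \<otimes> inv b \<in> U"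
  shows "\<tau> closure_of B \<subseteq> H"
proof
  fix p assume p: "p \<in> \<tau> closure_of B"
  have top: "topspace \<tau> = carrier G"
    using \<tau> by (simp add: topological_group_def)
  have Uc: "U \<subseteq> carrier G"
    using U(1) B.subset by blast
  have pc: "p \<in> carrier G"
    using p top by (simp add: in_closure_of)
  have "inv p \<otimes> u \<otimes> p \<in> H" if u: "u \<in> U" for u
  proof -
    have "inv b \<otimes> u \<otimes> b \<in> \<tau> closure_of U" if b: "b \<in> B" for b
      using norm[of "inv b" u] b u closure_of_subset[of U \<tau>] Uc top by auto
    then have "inv p \<otimes> u \<otimes> p \<in> \<tau> closure_of U"
      using u Uc top
      by (intro continuous_map_closure_of_mem[OF _ p, of \<tau> "\<lambda>x. inv x \<otimes> u \<otimes> x"])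
        (auto intro!: topological_group_continuous_intros[OF \<tau>(1)])
    then show ?thesis
      using closure_nilpotent_subset_H[OF \<tau> U norm] by blast
  qed
  then show "p \<in> H"
    using in_H_if_conj_subset[OF pc Uc U(2) norm] by blast
qed

theorem finite_lcosets_if_compact:
  assumes \<tau>: "topological_group G \<tau>" "compact_space \<tau>" "Hausdorff_space \<tau>"
    and U: "U \<subseteq> B" "B \<subseteq> U <#> (B \<inter> N)" "nilpotent_subgroup G U"
    and norm: "\<And>b u. \<lbrakk>b \<in> B; u \<in> U\<rbrakk> \<Longrightarrow> b \<otimes> u \<otimes> inv b \<in> U"
  shows "finite (lcosets B)"
proof -
  define P where "P = \<tau> closure_of B"
  have top: "topspace \<tau> = carrier G"
    using \<tau> by (simp add: topological_group_def)
  have BP: "B \<subseteq> P"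
    unfolding P_def using closure_of_subset[of B \<tau>] B.subset top by simp
  have P: "subgroup P G" "closedin \<tau> P"
    unfolding P_def using topological_group_subgroup_closure_of[OF \<tau>(1) subgroup_B] by auto
  obtain R where R: "finite R" "R \<subseteq> N"
    "\<And>g. g \<in> carrier G \<Longrightarrow> \<exists>b\<in>B. \<exists>r\<in>R. \<exists>b'\<in>B. g = b \<otimes> r \<otimes> b'"
    using finite_representatives by blast
  have "openin \<tau> P"
  proof (rule compact_group_openin_closed_subgroup[OF \<tau> P R(1)])
    show "R \<subseteq> carrier G"
      using R(2) N.subset by blast
    show "\<exists>p\<in>P. \<exists>r\<in>R. \<exists>q\<in>P. g = p \<otimes> r \<otimes> q" if "g \<in> carrier G" for g
      using R(3)[OF that] BP by blast
  qed
  then obtain F where F: "finite F" "F \<subseteq> carrier G" "carrier G \<subseteq> F <#> P"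
    using compact_group_openin_subgroup_finitely_covers[OF \<tau>(1,2) P(1)] by blast
  obtain E where E: "finite E" "E \<subseteq> carrier G" "H \<subseteq> E <#> B"
    using H_finitely_covered .
  \<comment> \<open>The two finite coverings, of \<open>G\<close> by cosets of \<open>P\<close> and
    of \<open>P\<close> by cosets of \<open>B\<close>, multiply to one of \<open>G\<close> by cosets
    of \<open>B\<close>.\<close>
  have "P \<subseteq> E <#> B"
    using closure_B_subset_H[OF \<tau>(1,3) U norm] E(3) unfolding P_def by blast
  then have "F <#> P \<subseteq> F <#> (E <#> B)"
    by (intro mono_set_mult) auto
  also have "\<dots> = (F <#> E) <#> B"
    using F E B.subset by (simp add: set_mult_assoc)
  finally have "carrier G \<subseteq> (F <#> E) <#> B"
    using F(3) by blast
  then show ?thesis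
    using F E
    by (intro finite_lcosets_if_finitely_covered[OF subgroup_B])
      (auto simp: finite_set_mult dest: subsetD[OF set_mult_closed])
qed

end

section \<open>BN-pairs\<close>

text \<open>Let \<open>D = B N B\<close> and let \<open>K\<close> consist of the elements whose left
  translation maps \<open>D\<close> into itself. \<open>K\<close> is closed under products and
  contains \<open>B\<close>; the exchange axiom puts the members of each \<open>s \<in> S\<close>
  into \<open>K\<close>. Hence \<open>K\<close> contains \<open>N\<close> and then all of
  \<open>G\<close>, and applying this to the unit of \<open>D\<close> gives the claim.\<close>

lemma BN_pair_bruhat:
  assumes BN: "BN_pair G B N S" and g: "g \<in> carrier G"
  shows "\<exists>b\<in>B. \<exists>n\<in>N. \<exists>b'\<in>B. g = b \<otimes>\<^bsub>G\<^esub> n \<otimes>\<^bsub>G\<^esub> b'"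
proof -
  let ?W = "weyl_group G B N"
  interpret group G
    using BN by (simp add: BN_pair_def)
  interpret B: subgroup B G
    using BN by (simp add: BN_pair_def)
  interpret N: subgroup N G
    using BN by (simp add: BN_pair_def)
  have normal: "normal (B \<inter> N) (G\<lparr>carrier := N\<rparr>)"
    using BN by (simp add: BN_pair_def)
  interpret W: group ?W
    unfolding weyl_group_def using normal by (rule normal.factorgroup_is_group)
  have W_mult: "v \<otimes>\<^bsub>?W\<^esub> w = v <#>\<^bsub>G\<^esub> w" for v w
    by (simp add: weyl_group_def FactGroup_def set_mult_def)
  have W_one: "\<one>\<^bsub>?W\<^esub> = B \<inter> N"
    by (simp add: weyl_group_def FactGroup_def)
  have W_carrier: "carrier ?W = (\<lambda>n. (B \<inter> N) #>\<^bsub>G\<^esub> n) ` N"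
    by (auto simp: weyl_group_def FactGroup_def RCOSETS_def r_coset_def)
  have S: "S \<subseteq> carrier ?W" "generate ?W S = carrier ?W"
    "\<And>s. s \<in> S \<Longrightarrow> s \<otimes>\<^bsub>?W\<^esub> s = \<one>\<^bsub>?W\<^esub>"
    using BN by (auto simp: BN_pair_def)
  have exchange: "\<forall>s\<in>S. \<forall>w\<in>carrier ?W. \<forall>ns\<in>s. \<forall>nw\<in>w.
        (ns <#\<^bsub>G\<^esub> B) #>\<^bsub>G\<^esub> nw \<subseteq>
          ((B #>\<^bsub>G\<^esub> nw) <#>\<^bsub>G\<^esub> B) \<union> ((B #>\<^bsub>G\<^esub> (ns \<otimes>\<^bsub>G\<^esub> nw)) <#>\<^bsub>G\<^esub> B)"
    using BN unfolding BN_pair_def by (elim conjE)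
  have T: "subgroup (B \<inter> N) G"
    by (rule subgroups_Inter_pair) unfold_locales
  have self: "n \<in> (B \<inter> N) #>\<^bsub>G\<^esub> n" if "n \<in> N" for n
    using rcos_self[OF _ T] that by auto
  define D where "D = {b \<otimes>\<^bsub>G\<^esub> n \<otimes>\<^bsub>G\<^esub> b' | b n b'. b \<in> B \<and> n \<in> N \<and> b' \<in> B}"
  define K where "K = {g \<in> carrier G. \<forall>x\<in>D. g \<otimes>\<^bsub>G\<^esub> x \<in> D}"
  have DI: "b \<otimes>\<^bsub>G\<^esub> n \<otimes>\<^bsub>G\<^esub> b' \<in> D" if "b \<in> B" "n \<in> N" "b' \<in> B" for b n b'
    using that unfolding D_def by blast
  have D_carrier: "D \<subseteq> carrier G"
    by (auto simp: D_def)
  have D_right: "x \<otimes>\<^bsub>G\<^esub> b \<in> D" if x: "x \<in> D" and b: "b \<in> B" for x b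
  proof -
    obtain c n c' where "c \<in> B" "n \<in> N" "c' \<in> B" "x = c \<otimes>\<^bsub>G\<^esub> n \<otimes>\<^bsub>G\<^esub> c'"
      using x unfolding D_def by blast
    then show ?thesis
      using DI[of c n "c' \<otimes>\<^bsub>G\<^esub> b"] b by (simp add: m_assoc)
  qed
  have B_K: "B \<subseteq> K"
  proof
    fix b assume b: "b \<in> B"
    have "b \<otimes>\<^bsub>G\<^esub> x \<in> D" if x: "x \<in> D" for x
    proof -
      obtain c n c' where "c \<in> B" "n \<in> N" "c' \<in> B" "x = c \<otimes>\<^bsub>G\<^esub> n \<otimes>\<^bsub>G\<^esub> c'"
        using x unfolding D_def by blast
      then show ?thesis
        using DI[of "b \<otimes>\<^bsub>G\<^esub> c" n c'] b by (simp add: m_assoc)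
    qed
    then show "b \<in> K"
      using b by (simp add: K_def)
  qed
  have K_mult: "g \<otimes>\<^bsub>G\<^esub> h \<in> K" if "g \<in> K" "h \<in> K" for g h
    using that D_carrier by (auto simp: K_def m_assoc subset_iff)
  have S_K: "s \<subseteq> K" if s: "s \<in> S" for s
  proof
    fix m assume m: "m \<in> s"
    then have mN: "m \<in> N"
      using S(1) s W_carrier by (auto simp: r_coset_def)
    have "m \<otimes>\<^bsub>G\<^esub> x \<in> D" if x: "x \<in> D" for x
    proof -
      obtain b n b' where bnb': "b \<in> B" "n \<in> N" "b' \<in> B" "x = b \<otimes>\<^bsub>G\<^esub> n \<otimes>\<^bsub>G\<^esub> b'"
        using x unfolding D_def by blast
      \<comment> \<open>The exchange axiom for the coset of \<open>n\<close>: the element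
        \<open>m b n\<close> falls into \<open>B n B\<close> or \<open>B m n B\<close>, and both lie
        in \<open>D\<close>.\<close>
      have "(m <#\<^bsub>G\<^esub> B) #>\<^bsub>G\<^esub> n \<subseteq>
          ((B #>\<^bsub>G\<^esub> n) <#>\<^bsub>G\<^esub> B) \<union> ((B #>\<^bsub>G\<^esub> (m \<otimes>\<^bsub>G\<^esub> n)) <#>\<^bsub>G\<^esub> B)"
        using exchange s m self[OF bnb'(2)] imageI[OF bnb'(2)] unfolding W_carrier by meson
      moreover have "m \<otimes>\<^bsub>G\<^esub> b \<otimes>\<^bsub>G\<^esub> n \<in> (m <#\<^bsub>G\<^esub> B) #>\<^bsub>G\<^esub> n"
        using bnb'(1) by (auto simp: l_coset_def r_coset_def)
      moreover have "(B #>\<^bsub>G\<^esub> k) <#>\<^bsub>G\<^esub> B \<subseteq> D" if "k \<in> N" for k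
        using that DI by (auto simp: r_coset_def set_mult_def)
      ultimately have "m \<otimes>\<^bsub>G\<^esub> b \<otimes>\<^bsub>G\<^esub> n \<in> D"
        using bnb'(2) mN N.m_closed by blast
      then show ?thesis
        using D_right[of "m \<otimes>\<^bsub>G\<^esub> b \<otimes>\<^bsub>G\<^esub> n" b'] bnb' mN by (simp add: m_assoc)
    qed
    then show "m \<in> K"
      using mN by (simp add: K_def)
  qed
  \<comment> \<open>Elements of the Weyl group are cosets, hence subsets of \<open>N\<close>, and
    their product is the product of sets. \<open>K\<close> is not known to be closed under inverses;
    generators from \<open>S\<close> are their own inverses.\<close>
  have W_K: "w \<subseteq> K" if "w \<in> generate ?W S" for w
    using that
  proof induction
    case one
    then show ?case
      using B_K W_one by auto
  next
    case (incl s)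
    then show ?case
      by (rule S_K)
  next
    case (inv s)
    then have "inv\<^bsub>?W\<^esub> s = s"
      using S W.inv_equality by blast
    then show ?case
      using S_K inv by simp
  next
    case (eng v w)
    then show ?case
      using K_mult by (auto simp: W_mult set_mult_def)
  qed
  have N_K: "N \<subseteq> K"
    using W_K self S(2) W_carrier by blast
  \<comment> \<open>Inverses of generators cause no difficulty here, since \<open>B\<close> and
    \<open>N\<close> are subgroups.\<close>
  have "h \<in> K" if "h \<in> generate G (B \<union> N)" for h
    using that
  proof induction
    case one
    then show ?case
      using B_K by auto
  next
    case (incl h)
    then show ?case
      using B_K N_K by blast
  next
    case (inv h)
    then show ?case
      using B_K N_K by blast
  next
    case (eng h1 h2)
    then show ?case
      using K_mult by blast
  qed
  then have "g \<in> K"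
    using BN g by (simp add: BN_pair_def)
  moreover have "\<one>\<^bsub>G\<^esub> \<in> D"
    using DI[of "\<one>\<^bsub>G\<^esub>" "\<one>\<^bsub>G\<^esub>" "\<one>\<^bsub>G\<^esub>"] by simp
  ultimately have "g \<otimes>\<^bsub>G\<^esub> \<one>\<^bsub>G\<^esub> \<in> D"
    unfolding K_def by blast
  then show ?thesis
    using g unfolding D_def by auto
qed

lemma spherical_BN_pair_finite_bruhat_decomposition:
  assumes "spherical_BN_pair G B N S"
  shows "finite_bruhat_decomposition G B N"
proof -
  have BN: "BN_pair G B N S"
    using assms by (simp add: spherical_BN_pair_def)
  interpret group G
    using BN by (simp add: BN_pair_def)
  have N: "subgroup N G" and normal: "normal (B \<inter> N) (G\<lparr>carrier := N\<rparr>)"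
    using BN by (auto simp: BN_pair_def)
  show ?thesis
  proof (intro finite_bruhat_decomposition.intro finite_bruhat_decomposition_axioms.intro)
    show "group G" ..
    show "subgroup B G" "subgroup N G"
      using BN by (auto simp: BN_pair_def)
    show "n \<otimes>\<^bsub>G\<^esub> t \<otimes>\<^bsub>G\<^esub> inv\<^bsub>G\<^esub> n \<in> B \<inter> N" if "n \<in> N" "t \<in> B \<inter> N" for n t
      using normal.inv_op_closed2[OF normal, of n t] that by (simp add: m_inv_consistent[OF N])
    have "carrier (weyl_group G B N) = (\<lambda>n. (B \<inter> N) #>\<^bsub>G\<^esub> n) ` N"
      by (auto simp: weyl_group_def FactGroup_def RCOSETS_def r_coset_def)
    then show "finite ((\<lambda>n. (B \<inter> N) #>\<^bsub>G\<^esub> n) ` N)"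
      using assms by (simp add: spherical_BN_pair_def)
    show "\<exists>b\<in>B. \<exists>n\<in>N. \<exists>b'\<in>B. g = b \<otimes>\<^bsub>G\<^esub> n \<otimes>\<^bsub>G\<^esub> b'" if "g \<in> carrier G" for g
      using BN_pair_bruhat[OF BN that] .
  qed
qed

theorem theorem2:
  fixes G :: "('a, 'b) monoid_scheme" and T :: "'a topology"
    and B N :: "'a set" and S :: "'a set set"
  assumes "topological_group G T"
    and "compact_space T" and "Hausdorff_space T"
    and "split_BN_pair G B N S" and "spherical_BN_pair G B N S"
  shows "finite (lcosets\<^bsub>G\<^esub> B)"
proof -
  interpret finite_bruhat_decomposition G B N
    using assms(5) by (rule spherical_BN_pair_finite_bruhat_decomposition)
  obtain U where U: "normal U (G\<lparr>carrier := B\<rparr>)" "nilpotent_subgroup G U"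
    "U <#>\<^bsub>G\<^esub> (B \<inter> N) = B"
    using assms(4) unfolding split_BN_pair_def by blast
  have "U \<subseteq> B"
    using subgroup.subset[OF normal_imp_subgroup[OF U(1)]] by simp
  \<comment> \<open>Normality of \<open>U\<close> is stated in the group with carrier
    \<open>B\<close>; \<open>m_inv_consistent\<close> identifies its inverses with those of
    \<open>G\<close>.\<close>
  moreover have "b \<otimes>\<^bsub>G\<^esub> u \<otimes>\<^bsub>G\<^esub> inv\<^bsub>G\<^esub> b \<in> U" if "b \<in> B" "u \<in> U" for b u
    using normal.inv_op_closed2[OF U(1), of b u] that by (simp add: m_inv_consistent[OF subgroup_B])
  ultimately show ?thesis
    using finite_lcosets_if_compact[OF assms(1-3) _ _ U(2)] U(3) by blast
qed

end
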